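(* Let $A=[a_{ij}]_{i,j=0}^n\in\mathrm{Sym}(\mathbb R^{n+1})$ with $A\neq\mathrm{diag}(0,A^+)$. Then $$\widehat\Theta(A)=\lim_{p\to\infty}\mathrm{tr}\tan^{-1}(A_p)=\frac\pi2\,\mathrm{sign}(a_{00})+\sum_{j=1}^n\tan^{-1}\mu_j(A).$$
   Context: $I_n=\mathrm{diag}(0,1,\dots,1)$, $I_n^p=\mathrm{diag}(p,1,\dots,1)$, $A_p=I_n^pAI_n^p$, $A^+=[a_{ij}]_{i,j=1}^n$. $\arg\in(-\pi,\pi]$, $\tan^{-1}\in(-\pi/2,\pi/2)$ (via eigenvalues for symmetric matrices); $\mathrm{sign}(x)\in\{-1,0,1\}$. $\widehat\Theta(A)=\sum_{\lambda\in\mathrm{spec}(I_n+\sqrt{-1}A)}m(\lambda)\arg\lambda$ with $m(\lambda)$ the algebraic multiplicity. $\sigma_j(M)$ is the sum of principal $j\times j$ minors ($\sigma_0=1$, $\sigma_j=0$ beyond the size); $\rho_i(A)=\sigma_i(A)-\sigma_i(A^+)$ for $i\le n$, $\rho_{n+1}(A)=\sigma_{n+1}(A)$; $\chi_A^\infty(\mu)=\sum_{i=0}^n(-\mu)^i\rho_{n+1-i}(A)$, whose roots are all real. If $a_{00}\ne0$, $\mu_1(A)\ge\dots\ge\mu_n(A)$ are its $n$ roots; if $a_{00}=0$, $\mu_1(A)\ge\dots\ge\mu_{n-1}(A)$ are its $n-1$ roots and $\mu_n(A):=0$. *)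

theory Defs
  imports "HOL-Analysis.Analysis" "Jordan_Normal_Form.Char_Poly" "Jordan_Normal_Form.DL_Submatrix"
    "HOL-Computational_Algebra.Polynomial"
begin

definition sym_mat :: "nat \<Rightarrow> real mat \<Rightarrow> bool" where
  "sym_mat m A \<longleftrightarrow> A \<in> carrier_mat m m \<and> transpose_mat A = A"

definition Aplus :: "nat \<Rightarrow> real mat \<Rightarrow> real mat" where
  "Aplus n A = mat n n (\<lambda>(i,j). A $$ (i+1, j+1))"

definition diag0_Aplus :: "nat \<Rightarrow> real mat \<Rightarrow> real mat" where
  "diag0_Aplus n A = mat (n+1) (n+1) (\<lambda>(i,j). if i = 0 \<or> j = 0 then 0 else Aplus n A $$ (i-1, j-1))"

definition Ip :: "nat \<Rightarrow> real \<Rightarrow> real mat" where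
  "Ip n p = mat (n+1) (n+1) (\<lambda>(i,j). if i = j then (if i = 0 then p else 1) else 0)"

definition A_p :: "nat \<Rightarrow> real mat \<Rightarrow> real \<Rightarrow> real mat" where
  "A_p n A p = Ip n p * A * Ip n p"

definition In_plus_iA :: "nat \<Rightarrow> real mat \<Rightarrow> complex mat" where
  "In_plus_iA n A = mat (n+1) (n+1)
     (\<lambda>(i,j). (if i = j \<and> i \<noteq> 0 then 1 else 0) + \<i> * complex_of_real (A $$ (i,j)))"

definition Theta_hat :: "nat \<Rightarrow> real mat \<Rightarrow> real" where
  "Theta_hat n A = (\<Sum>x\<in># proots (char_poly (In_plus_iA n A)). Arg x)"

text \<open>tr tan^{-1}(M) for a real symmetric M, tan^{-1}(M) being defined through the
  eigenvalues: the trace is the sum of arctan over the eigenvalues (with multiplicity).\<close>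
definition tr_arctan :: "real mat \<Rightarrow> real" where
  "tr_arctan M = (\<Sum>x\<in># proots (char_poly M). arctan x)"

definition sigma :: "nat \<Rightarrow> real mat \<Rightarrow> real" where
  "sigma j M = (\<Sum>S\<in>{S. S \<subseteq> {0..<dim_row M} \<and> card S = j}. det (submatrix M S S))"

definition rho :: "nat \<Rightarrow> nat \<Rightarrow> real mat \<Rightarrow> real" where
  "rho n i A = (if i \<le> n then sigma i A - sigma i (Aplus n A) else sigma (n+1) A)"

definition chi_inf :: "nat \<Rightarrow> real mat \<Rightarrow> real poly" where
  "chi_inf n A = (\<Sum>i\<le>n. Polynomial.smult (rho n (n+1-i) A) ([:0, -1:] ^ i))"

text \<open>mu_1(A) >= ... >= mu_n(A): the real roots of chi (with multiplicity) in decreasing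
  order, followed by mu_n := 0 when a_00 = 0.  mu n A j is mu_j(A) for 1 <= j <= n.\<close>
definition mu_list :: "nat \<Rightarrow> real mat \<Rightarrow> real list" where
  "mu_list n A = rev (sorted_list_of_multiset (proots (chi_inf n A)))
                 @ (if A $$ (0,0) = 0 then [0] else [])"

definition mu :: "nat \<Rightarrow> real mat \<Rightarrow> nat \<Rightarrow> real" where
  "mu n A j = mu_list n A ! (j - 1)"

end

theory Submission
  imports Defs
begin

text \<open>
  For a diagonal matrix \<open>D\<close> with nonnegative real part and a real symmetric \<open>A\<close>, the pivot
  \<open>det (D + iA) / det (D\<^sup>+ + iA\<^sup>+)\<close> has nonnegative real part, so its argument varies continuously
  as long as it does not vanish. Along a path \<open>D = D(s)\<close>, \<open>s \<ge> 0\<close>, on which the numerator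
  factors as \<open>c \<Prod>(x + s)\<close> and the denominator as \<open>\<Prod>(y + s)\<close>, the difference between this
  argument and \<open>Arg c + \<Sum> Arg (x + s) - \<Sum> Arg (y + s)\<close> is continuous with values in \<open>2\<pi>\<int>\<close> and
  smaller than \<open>2\<pi>\<close> for large \<open>s\<close>, hence zero. The paths \<open>diag(s,1+s,\<dots>,1+s)\<close> for \<open>A\<close>,
  \<open>diag(1+s,\<dots>,1+s)\<close> for \<open>A\<^sub>p\<close> and \<open>diag(0,1+s,\<dots>,1+s)\<close> for \<open>A\<close> express the three quantities of
  the theorem as \<open>tr tan\<^sup>-\<^sup>1(A\<^sup>+)\<close> plus the argument of a pivot at \<open>s = 0\<close>. For the first and the
  third it is the same pivot \<open>q\<close>, and for the second it is a positive multiple of \<open>q + p\<^sup>-\<^sup>2\<close>.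
\<close>

section \<open>Arguments of products and real-rooted polynomials\<close>

lemma cis_sum_mset_Arg:
  fixes X :: "complex multiset"
  assumes "\<And>x. x \<in># X \<Longrightarrow> h x \<noteq> 0"
  shows "cis (\<Sum>x\<in>#X. Arg (h x)) = sgn (\<Prod>x\<in>#X. h x)"
  using assms
proof (induction X)
  case (add x X)
  then have "cis (\<Sum>x\<in>#X. Arg (h x)) = sgn (\<Prod>x\<in>#X. h x)" and "h x \<noteq> 0" by auto
  then show ?case by (simp add: sgn_mult cis_Arg flip: cis_mult)
qed simp

lemma not_nonpos_Reals_if_Re_nonneg:
  assumes "Re z \<ge> 0" "z \<noteq> 0"
  shows "z \<notin> \<real>\<^sub>\<le>\<^sub>0"
  using assms by (auto simp: complex_nonpos_Reals_iff complex_eq_iff)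

lemma add_of_real_ne_0:
  assumes "Re x \<ge> 0" "x \<noteq> 0" "s \<ge> 0"
  shows "Re (x + of_real s) \<ge> 0" "x + of_real s \<noteq> 0"
  using assms by (auto simp: complex_eq_iff)

lemma continuous_on_sum_mset_Arg:
  fixes X :: "complex multiset"
  assumes "\<And>x. x \<in># X \<Longrightarrow> Re x \<ge> 0 \<and> x \<noteq> 0"
  shows "continuous_on {0..} (\<lambda>s::real. \<Sum>x\<in>#X. Arg (x + of_real s))"
  using assms
proof (induction X)
  case (add x X)
  have "continuous_on {0..} (\<lambda>s::real. Arg (x + of_real s))"
    using add.prems[of x] not_nonpos_Reals_if_Re_nonneg add_of_real_ne_0
    by (intro continuous_on_Arg' continuous_intros) auto
  then show ?case
    using add by (auto intro!: continuous_intros)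
qed auto

text \<open>Once \<open>s\<close> exceeds \<open>- Re x\<close>, the point lies in the open right
  half-plane, where \<open>Arg\<close> is the arctangent of a quotient tending to 0.\<close>

lemma tendsto_Arg_add_of_real: "((\<lambda>s::real. Arg (x + of_real s)) \<longlongrightarrow> 0) at_top"
proof -
  have "((\<lambda>s. Im x / (Re x + s)) \<longlongrightarrow> 0) at_top"
    by (rule tendsto_divide_0[OF tendsto_const filterlim_at_top_imp_at_infinity])
       (rule filterlim_tendsto_add_at_top[OF tendsto_const filterlim_ident])
  then have "((\<lambda>s. arctan (Im x / (Re x + s))) \<longlongrightarrow> arctan 0) at_top"
    by (rule tendsto_arctan)
  moreover have "eventually (\<lambda>s. arctan (Im x / (Re x + s)) = Arg (x + of_real s)) at_top"
    using eventually_gt_at_top[of "- Re x"]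
    by eventually_elim (simp add: arg_conv_arctan)
  ultimately show ?thesis
    by (simp add: tendsto_cong)
qed

lemma tendsto_sum_mset_Arg_add_of_real:
  "((\<lambda>s::real. \<Sum>x\<in>#X. Arg (x + of_real s)) \<longlongrightarrow> 0) at_top"
proof (induction X)
  case (add x X)
  from tendsto_add[OF tendsto_Arg_add_of_real[of x] add] show ?case by simp
qed auto

lemma cis_eq_1_iff: "cis t = 1 \<longleftrightarrow> (\<exists>k::int. t = 2 * pi * of_int k)"
proof -
  have "cis t = 1 \<longleftrightarrow> exp (\<i> * of_real t) = 1"
    by (simp add: cis_conv_exp)
  also have "\<dots> \<longleftrightarrow> (\<exists>k::int. t = 2 * pi * of_int k)"
    by (simp add: exp_eq_1 mult_ac)
  finally show ?thesis .
qed

text \<open>The values lie in the integer multiples of 2 pi, so distinct ones are at least 2 pi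
  apart; a continuous function with such a range is constant on a connected set.\<close>

lemma continuous_on_cis_eq_1_constant:
  fixes g :: "real \<Rightarrow> real"
  assumes cont: "continuous_on S g" and conn: "connected S"
    and g: "\<And>s. s \<in> S \<Longrightarrow> cis (g s) = 1"
  shows "g constant_on S"
proof (rule continuous_discrete_range_constant[OF conn cont])
  fix x assume "x \<in> S"
  have "2 * pi \<le> norm (g y - g x)" if y: "y \<in> S" "g y \<noteq> g x" for y
  proof -
    from g[OF y(1)] obtain k where k: "g y = 2 * pi * of_int k" by (auto simp: cis_eq_1_iff)
    from g[OF \<open>x \<in> S\<close>] obtain l where l: "g x = 2 * pi * of_int l" by (auto simp: cis_eq_1_iff)
    from y k l have "k \<noteq> l" by auto
    then have "1 \<le> \<bar>k - l\<bar>" by linarith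
    then have "(1::real) \<le> \<bar>of_int k - of_int l\<bar>"
      by (metis of_int_1_le_iff of_int_abs of_int_diff)
    then have "2 * pi * 1 \<le> 2 * pi * \<bar>of_int k - of_int l :: real\<bar>"
      by (intro mult_left_mono) auto
    also have "\<dots> = norm (g y - g x)"
      by (simp add: k l abs_mult flip: right_diff_distrib)
    finally show ?thesis by simp
  qed
  then show "\<exists>e>0. \<forall>y. y \<in> S \<and> g y \<noteq> g x \<longrightarrow> e \<le> norm (g y - g x)"
    by (intro exI[of _ "2 * pi"]) auto
qed

text \<open>\<open>Arg\<close> is additive only modulo 2 pi. Assumption \<open>f\<close> keeps the
  quotient off the branch cut for every shift, so the defect \<open>g\<close> of additivity does not
  depend on the shift and can be evaluated at a large one.\<close>

lemma Arg_prod_quotient: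
  fixes X Y :: "complex multiset"
  assumes X: "\<And>x. x \<in># X \<Longrightarrow> Re x \<ge> 0 \<and> x \<noteq> 0"
    and Y: "\<And>y. y \<in># Y \<Longrightarrow> Re y \<ge> 0 \<and> y \<noteq> 0"
    and c: "c \<noteq> 0" "Re c \<ge> 0"
    and f: "\<And>s::real. s \<ge> 0 \<Longrightarrow>
      Re (c * (\<Prod>x\<in>#X. x + of_real s) / (\<Prod>y\<in>#Y. y + of_real s)) \<ge> 0"
  shows "Arg (c * \<Prod>\<^sub># X / \<Prod>\<^sub># Y) = Arg c + (\<Sum>x\<in>#X. Arg x) - (\<Sum>y\<in>#Y. Arg y)"
proof -
  define F where "F = (\<lambda>s::real. c * (\<Prod>x\<in>#X. x + of_real s) / (\<Prod>y\<in>#Y. y + of_real s))"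
  define SX where "SX = (\<lambda>s::real. \<Sum>x\<in>#X. Arg (x + of_real s))"
  define SY where "SY = (\<lambda>s::real. \<Sum>y\<in>#Y. Arg (y + of_real s))"
  define g where "g = (\<lambda>s. Arg (F s) - Arg c - SX s + SY s)"
  have nzX: "(\<Prod>x\<in>#X. x + of_real s) \<noteq> 0" and nzY: "(\<Prod>y\<in>#Y. y + of_real s) \<noteq> 0"
    if "s \<ge> 0" for s :: real
    using X Y add_of_real_ne_0(2)[OF _ _ that] by (force simp: prod_mset_zero_iff)+
  have F: "F s \<noteq> 0" "Re (F s) \<ge> 0" if "s \<ge> 0" for s
    using nzX[OF that] nzY[OF that] c(1) f[OF that] by (simp_all add: F_def)
  have cont_prod: "continuous_on {0..} (\<lambda>s::real. \<Prod>x\<in>#Z. x + of_real s)" for Z :: "complex multiset"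
    by (induction Z) (auto intro!: continuous_intros)
  have "continuous_on {0..} F"
    unfolding F_def using nzY by (intro continuous_intros cont_prod) auto
  then have "continuous_on {0..} (\<lambda>s. Arg (F s))"
    using F not_nonpos_Reals_if_Re_nonneg by (intro continuous_on_Arg') auto
  then have "continuous_on {0..} g"
    unfolding g_def SX_def SY_def
    using continuous_on_sum_mset_Arg[of X, OF X] continuous_on_sum_mset_Arg[of Y, OF Y]
    by (intro continuous_on_add continuous_on_diff continuous_on_const) auto
  moreover have cis_g: "cis (g s) = 1" if s: "s \<in> {0..}" for s
  proof -
    have SX: "cis (SX s) = sgn (\<Prod>x\<in>#X. x + of_real s)"
      unfolding SX_def using s X add_of_real_ne_0 by (intro cis_sum_mset_Arg) auto
    have SY: "cis (SY s) = sgn (\<Prod>y\<in>#Y. y + of_real s)"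
      unfolding SY_def using s Y add_of_real_ne_0 by (intro cis_sum_mset_Arg) auto
    have "cis (g s) = sgn (F s) / sgn c / cis (SX s) * cis (SY s)"
      unfolding g_def using F[of s] s c by (simp add: cis_Arg flip: cis_divide cis_mult)
    also have "\<dots> = 1"
      unfolding SX SY F_def using nzX[of s] nzY[of s] s c
      by (simp add: sgn_mult sgn_divide sgn_zero_iff)
    finally show ?thesis .
  qed
  ultimately have "g constant_on {0..}"
    by (intro continuous_on_cis_eq_1_constant) auto
  then obtain K where K: "\<And>s. s \<ge> 0 \<Longrightarrow> g s = K" by (auto simp: constant_on_def)
  have "((\<lambda>s. SY s - SX s) \<longlongrightarrow> 0 - 0) at_top"
    unfolding SX_def SY_def by (intro tendsto_diff tendsto_sum_mset_Arg_add_of_real)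
  then have "eventually (\<lambda>s. dist (SY s - SX s) 0 < pi) at_top"
    by (intro tendstoD) auto
  with eventually_ge_at_top[of "0::real"] have "eventually (\<lambda>s. s \<ge> 0 \<and> \<bar>SY s - SX s\<bar> < pi) at_top"
    by eventually_elim (auto simp: dist_real_def)
  then obtain s where s: "s \<ge> 0" "\<bar>SY s - SX s\<bar> < pi"
    by (auto simp: eventually_at_top_linorder)
  \<comment> \<open>These two arguments contribute at most pi together. The shift was taken so large
    that the remaining sums contribute strictly less than pi, which leaves 0 as the only multiple of
    2 pi.\<close>
  have "\<bar>Arg (F s)\<bar> \<le> pi / 2" "\<bar>Arg c\<bar> \<le> pi / 2"
    using F(2)[OF s(1)] c Arg_Re_nonneg by blast+
  with s have "\<bar>g s\<bar> < 2 * pi"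
    unfolding g_def by linarith
  moreover obtain k where k: "g s = 2 * pi * of_int k"
    using cis_g[of s] s by (auto simp: cis_eq_1_iff)
  ultimately have "\<bar>of_int k :: real\<bar> < 1"
    by (simp add: abs_mult)
  then have "k = 0" by linarith
  with k K[of s] K[of 0] s have "g 0 = 0" by simp
  then show ?thesis
    by (simp add: g_def F_def SX_def SY_def)
qed

section \<open>Real polynomials without nonreal roots\<close>

text \<open>Roots of a real polynomial come in conjugate pairs, so excluding the upper half-plane
  excludes the lower one too. After all real roots are split off with their multiplicities, no
  complex root remains and the rest is constant.\<close>

lemma real_rooted_factorization:
  fixes p :: "real poly"
  assumes "p \<noteq> 0" "\<And>z::complex. Im z > 0 \<Longrightarrow> poly (map_poly of_real p) z \<noteq> 0"
  shows "p = Polynomial.smult (lead_coeff p) (\<Prod>x\<in>#proots p. [:-x, 1:])"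
  using assms
proof (induction p rule: poly_root_order_induct)
  case (no_roots p)
  have "degree p = 0"
  proof (rule ccontr)
    assume "degree p \<noteq> 0"
    then have "\<not> constant (poly (map_poly complex_of_real p))"
      by (simp add: constant_degree degree_map_poly)
    then obtain z where z: "poly (map_poly complex_of_real p) z = 0"
      using fundamental_theorem_of_algebra by blast
    then have "poly (map_poly complex_of_real p) (cnj z) = 0"
      by (subst real_poly_cnj_root_iff) (auto simp: coeff_map_poly)
    with z no_roots(3)[of z] no_roots(3)[of "cnj z"] have "Im z = 0"
      by (cases "Im z" "0::real" rule: linorder_cases) auto
    then have "z = of_real (Re z)" by (simp add: complex_eq_iff)
    with z have "poly p (Re z) = 0"
      by (metis of_real_eq_0_iff of_real_hom.poly_map_poly)
    with no_roots show False by auto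
  qed
  then show ?case by (auto elim!: degree_eq_zeroE)
next
  case (root p x n)
  have [simp]: "p \<noteq> 0" using root by auto
  interpret map_poly_comm_ring_hom complex_of_real
    by unfold_locales auto
  have IH: "p = Polynomial.smult (lead_coeff p) (\<Prod>x\<in>#proots p. [:-x, 1:])"
    using root by (intro root.IH) (auto simp: hom_distribs)
  have proots: "proots ([:- x, 1:] ^ n * p) = replicate_mset n x + proots p"
    by (simp add: proots_mult proots_power)
  have lc: "lead_coeff ([:- x, 1:] ^ n * p) = lead_coeff p"
    by (simp only: lead_coeff_mult lead_coeff_power) simp
  have "[:- x, 1:] ^ n * p =
      [:- x, 1:] ^ n * Polynomial.smult (lead_coeff p) (\<Prod>x\<in>#proots p. [:-x, 1:])"
    using IH by simp
  then show ?case
    unfolding proots lc by simp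
qed simp_all

lemma real_rooted_poly_eval:
  fixes p :: "real poly"
  assumes "p \<noteq> 0" "\<And>z::complex. Im z > 0 \<Longrightarrow> poly (map_poly of_real p) z \<noteq> 0"
  shows "poly (map_poly complex_of_real p) z =
      of_real (lead_coeff p) * (\<Prod>x\<in>#proots p. z - of_real x)"
    and "size (proots p) = degree p"
proof -
  note fact = real_rooted_factorization[OF assms]
  interpret map_poly_comm_ring_hom complex_of_real
    by unfold_locales auto
  have "poly (map_poly complex_of_real (Polynomial.smult a (\<Prod>x\<in>#X. [:-x, 1:]))) z =
      of_real a * (\<Prod>x\<in>#X. z - of_real x)" for a X
    by (induction X) (auto simp: hom_distribs left_diff_distrib)
  from this[of "lead_coeff p" "proots p"] show "poly (map_poly complex_of_real p) z =
      of_real (lead_coeff p) * (\<Prod>x\<in>#proots p. z - of_real x)"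
    using fact by simp
  have "degree (\<Prod>x\<in>#X. [:-x, 1:]) = size X" for X :: "real multiset"
  proof (induction X)
    case (add x X)
    have "(\<Prod>x\<in>#X. [:-x, 1:]) \<noteq> 0" by (auto simp: prod_mset_zero_iff)
    with add show ?case by (simp add: degree_mult_eq del: mult_pCons_left)
  qed simp
  with fact assms(1) show "size (proots p) = degree p"
    by (metis degree_smult_eq leading_coeff_0_iff)
qed

section \<open>The matrices \<open>D + iA\<close>\<close>

text \<open>The diagonal is left free because every matrix in the argument has this shape:
  \<open>I_n + iA\<close>, the identity plus \<open>i A_p\<close>, and, up to a scalar, the
  characteristic matrices, since a spectral parameter only changes \<open>d\<close>.\<close>

definition diag_plus_i :: "nat \<Rightarrow> (nat \<Rightarrow> complex) \<Rightarrow> real mat \<Rightarrow> complex mat" where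
  "diag_plus_i m d A = mat m m (\<lambda>(i,j). (if i = j then d i else 0) + \<i> * of_real (A $$ (i,j)))"

lemma diag_plus_i_carrier [simp]: "diag_plus_i m d A \<in> carrier_mat m m"
  and dim_diag_plus_i [simp]: "dim_row (diag_plus_i m d A) = m" "dim_col (diag_plus_i m d A) = m"
  and diag_plus_i_index: "i < m \<Longrightarrow> j < m \<Longrightarrow>
    diag_plus_i m d A $$ (i,j) = (if i = j then d i else 0) + \<i> * of_real (A $$ (i,j))"
  by (simp_all add: diag_plus_i_def)

lemma sym_mat_index:
  assumes "sym_mat m A" "i < m" "j < m"
  shows "A $$ (i,j) = A $$ (j,i)"
  using assms unfolding sym_mat_def by (metis carrier_matD index_transpose_mat(1))

text \<open>The form of a real symmetric \<open>A\<close> is Hermitian, so its value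
  \<open>Q\<close> is real and \<open>\<i> * Q\<close> has real part 0; only the diagonal is
  left.\<close>

lemma Re_quadratic_form_diag_plus_i:
  assumes A: "sym_mat m A" and v: "v \<in> carrier_vec m"
  shows "Re (\<Sum>i<m. cnj (v $ i) * (diag_plus_i m d A *\<^sub>v v) $ i)
    = (\<Sum>i<m. Re (d i) * (cmod (v $ i))\<^sup>2)"
proof -
  define Q where "Q = (\<Sum>i<m. \<Sum>j<m. of_real (A $$ (i,j)) * (cnj (v $ i) * v $ j))"
  have "cnj Q = (\<Sum>i<m. \<Sum>j<m. of_real (A $$ (i,j)) * (v $ i * cnj (v $ j)))"
    by (simp add: Q_def)
  also have "\<dots> = (\<Sum>j<m. \<Sum>i<m. of_real (A $$ (i,j)) * (v $ i * cnj (v $ j)))"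
    by (rule sum.swap)
  also have "\<dots> = Q"
    unfolding Q_def using sym_mat_index[OF A] by (intro sum.cong refl) (auto simp: mult_ac)
  finally have "Im Q = 0"
    by (simp add: complex_eq_iff)
  have "(diag_plus_i m d A *\<^sub>v v) $ i = d i * v $ i + \<i> * (\<Sum>j<m. of_real (A $$ (i,j)) * v $ j)"
    if "i < m" for i
  proof -
    have "(diag_plus_i m d A *\<^sub>v v) $ i = (\<Sum>j<m. diag_plus_i m d A $$ (i,j) * v $ j)"
      using that v by (simp add: scalar_prod_def lessThan_atLeast0)
    also have "\<dots> = (\<Sum>j<m. (if j = i then d i * v $ i else 0) + \<i> * (of_real (A $$ (i,j)) * v $ j))"
      using that by (intro sum.cong) (auto simp: diag_plus_i_index algebra_simps)
    finally show ?thesis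
      using that by (simp add: sum.distrib sum_distrib_left)
  qed
  then have "(\<Sum>i<m. cnj (v $ i) * (diag_plus_i m d A *\<^sub>v v) $ i)
      = (\<Sum>i<m. d i * of_real ((cmod (v $ i))\<^sup>2)
          + \<i> * (\<Sum>j<m. of_real (A $$ (i,j)) * (cnj (v $ i) * v $ j)))"
    by (intro sum.cong refl)
       (simp add: distrib_left sum_distrib_left complex_norm_square mult_ac del: of_real_power)
  also have "\<dots> = (\<Sum>i<m. d i * of_real ((cmod (v $ i))\<^sup>2)) + \<i> * Q"
    by (simp add: sum.distrib sum_distrib_left Q_def)
  finally show ?thesis
    using \<open>Im Q = 0\<close> by simp
qed

text \<open>For a kernel vector the quadratic form vanishes, which kills every coordinate with
  \<open>Re (d i) > 0\<close>. At most the coordinate 0 survives, and then column 0 of the matrix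
  would have to vanish.\<close>

lemma det_diag_plus_i_nonzero:
  assumes A: "sym_mat m A"
    and d: "\<And>i. 0 < i \<Longrightarrow> i < m \<Longrightarrow> Re (d i) > 0"
    and d0: "Re (d 0) > 0 \<or> d 0 = 0 \<and> (\<exists>j<m. A $$ (0,j) \<noteq> 0)"
  shows "det (diag_plus_i m d A) \<noteq> 0"
proof
  let ?B = "diag_plus_i m d A"
  assume "det ?B = 0"
  then obtain v where v: "v \<in> carrier_vec m" "v \<noteq> 0\<^sub>v m" "?B *\<^sub>v v = 0\<^sub>v m"
    using det_0_iff_vec_prod_zero[of ?B m] by auto
  have "(\<Sum>i<m. Re (d i) * (cmod (v $ i))\<^sup>2) = 0"
    using Re_quadratic_form_diag_plus_i[OF A v(1), of d] by (simp add: v(3))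
  moreover have nonneg: "Re (d i) \<ge> 0" if "i < m" for i
    using d[of i] d0 that by (cases "i = 0") auto
  ultimately have z: "Re (d i) * (cmod (v $ i))\<^sup>2 = 0" if "i < m" for i
    using that by (subst (asm) sum_nonneg_eq_0_iff) auto
  have vi: "v $ i = 0" if "0 < i" "i < m" for i
    using z[of i] d[of i] that by auto
  have "m > 0" using v by (cases m) auto
  have "v $ 0 \<noteq> 0"
  proof
    assume "v $ 0 = 0"
    with vi have "v $ i = 0" if "i < m" for i using that by (cases "i = 0") auto
    with v(1) have "v = 0\<^sub>v m" by (intro eq_vecI) auto
    with v(2) show False by simp
  qed
  \<comment> \<open>If \<open>Re (d 0) > 0\<close>, then \<open>z\<close> would force
    \<open>v $ 0 = 0\<close>; so the second alternative of \<open>d0\<close> holds.\<close>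
  with z[of 0] \<open>m > 0\<close> d0 obtain j where j: "j < m" "A $$ (0,j) \<noteq> 0" "d 0 = 0" by auto
  have "(?B *\<^sub>v v) $ j = (\<Sum>k<m. ?B $$ (j,k) * v $ k)"
    using j(1) v(1) by (simp add: scalar_prod_def lessThan_atLeast0)
  also have "\<dots> = (\<Sum>k\<in>{0}. ?B $$ (j,k) * v $ k)"
    using \<open>m > 0\<close> vi by (intro sum.mono_neutral_right) auto
  finally have "?B $$ (j,0) = 0"
    using v(3) j \<open>v $ 0 \<noteq> 0\<close> by simp
  then show False
    using j \<open>m > 0\<close> sym_mat_index[OF A, of 0 j] by (auto simp: diag_plus_i_index split: if_splits)
qed

lemma mat_delete_diag_plus_i:
  "mat_delete (diag_plus_i (Suc n) d A) 0 0 = diag_plus_i n (\<lambda>i. d (Suc i)) (Aplus n A)"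
  by (rule eq_matI) (auto simp: mat_delete_def diag_plus_i_def Aplus_def)

text \<open>The first column \<open>v\<close> of the adjugate of \<open>B\<close> satisfies \<open>B v = det B e\<^sub>0\<close>,
  so the product of determinants below is the quadratic form of \<open>B\<close> at \<open>v\<close>.\<close>

lemma Re_det_diag_plus_i_mult_cnj_minor:
  assumes A: "sym_mat (Suc n) A" and d: "\<And>i. i \<le> n \<Longrightarrow> Re (d i) \<ge> 0"
  shows "Re (det (diag_plus_i (Suc n) d A) *
    cnj (det (diag_plus_i n (\<lambda>i. d (Suc i)) (Aplus n A)))) \<ge> 0"
proof -
  let ?B = "diag_plus_i (Suc n) d A"
  define v where "v = col (adj_mat ?B) 0"
  note adj = adj_mat[OF diag_plus_i_carrier[of "Suc n" d A]]
  have v: "v \<in> carrier_vec (Suc n)"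
    unfolding v_def using col_dim[of "adj_mat ?B" 0] carrier_matD(1)[OF adj(1)] by simp
  have "?B *\<^sub>v v = col (?B * adj_mat ?B) 0"
    unfolding v_def by (rule col_mult2[symmetric, OF diag_plus_i_carrier adj(1)]) simp
  then have Bv: "(?B *\<^sub>v v) $ i = (if i = 0 then det ?B else 0)" if "i < Suc n" for i
    using that unfolding adj(2) by auto
  have "v $ 0 = det (diag_plus_i n (\<lambda>i. d (Suc i)) (Aplus n A))"
    by (simp add: v_def adj_mat_def cofactor_def mat_delete_diag_plus_i)
  moreover have "(\<Sum>i<Suc n. cnj (v $ i) * (?B *\<^sub>v v) $ i) = (\<Sum>i\<in>{0}. cnj (v $ i) * (?B *\<^sub>v v) $ i)"
    using Bv by (intro sum.mono_neutral_right) auto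
  moreover have "Re (\<Sum>i<Suc n. cnj (v $ i) * (?B *\<^sub>v v) $ i) \<ge> 0"
    unfolding Re_quadratic_form_diag_plus_i[OF A v] using d by (intro sum_nonneg) auto
  ultimately show ?thesis
    using Bv[of 0] by (simp add: mult_ac)
qed

text \<open>Dividing by a complex number and multiplying by its conjugate give real parts of the
  same sign. The quotient is the pivot at position (0,0).\<close>

lemma Re_det_diag_plus_i_divide_minor:
  assumes A: "sym_mat (Suc n) A" and d: "\<And>i. i \<le> n \<Longrightarrow> Re (d i) \<ge> 0"
  shows "Re (det (diag_plus_i (Suc n) d A) /
    det (diag_plus_i n (\<lambda>i. d (Suc i)) (Aplus n A))) \<ge> 0"
  using Re_det_diag_plus_i_mult_cnj_minor[OF assms]
  by (simp add: Re_complex_div_ge_0)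

text \<open>The cofactors along row 0 do not see the entry (0,0), so the two Laplace expansions
  differ in one term.\<close>

lemma det_update_00:
  assumes A: "A \<in> carrier_mat (Suc n) (Suc n)" and B: "B \<in> carrier_mat (Suc n) (Suc n)"
    and eq: "\<And>i j. i < Suc n \<Longrightarrow> j < Suc n \<Longrightarrow> (i,j) \<noteq> (0,0) \<Longrightarrow> A $$ (i,j) = B $$ (i,j)"
  shows "det A = det B + (A $$ (0,0) - B $$ (0,0)) * det (mat_delete B 0 0)"
proof -
  have "mat_delete A 0 j = mat_delete B 0 j" for j
    using A B eq by (intro eq_matI) (auto simp: mat_delete_def)
  then have cof: "cofactor A 0 j = cofactor B 0 j" for j
    by (simp add: cofactor_def)
  have "det A = (\<Sum>j<Suc n. A $$ (0,j) * cofactor B 0 j)"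
    by (subst laplace_expansion_row[OF A, of 0]) (simp_all add: cof)
  moreover have "det B = (\<Sum>j<Suc n. B $$ (0,j) * cofactor B 0 j)"
    by (subst laplace_expansion_row[OF B, of 0]) simp_all
  ultimately have "det A - det B = (\<Sum>j<Suc n. (A $$ (0,j) - B $$ (0,j)) * cofactor B 0 j)"
    by (simp add: sum_subtractf left_diff_distrib)
  also have "\<dots> = (\<Sum>j\<in>{0}. (A $$ (0,j) - B $$ (0,j)) * cofactor B 0 j)"
    using eq by (intro sum.mono_neutral_right) auto
  finally show ?thesis
    by (simp add: cofactor_def algebra_simps)
qed

text \<open>The determinant is affine in \<open>d 0\<close> with the minor as slope. Hence
  \<open>d 0\<close> enters the pivot as a summand, which is the source of the term
  \<open>1 / p\<^sup>2\<close>.\<close>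

lemma det_diag_plus_i_split:
  "det (diag_plus_i (Suc n) d A) = det (diag_plus_i (Suc n) (d(0 := 0)) A)
    + d 0 * det (diag_plus_i n (\<lambda>i. d (Suc i)) (Aplus n A))"
  by (subst det_update_00[of _ n "diag_plus_i (Suc n) (d(0 := 0)) A"])
     (auto simp: mat_delete_diag_plus_i diag_plus_i_index)

section \<open>Characteristic polynomials as determinants of \<open>D + iA\<close>\<close>

lemma poly_char_poly_diag_plus_i:
  "poly (char_poly (diag_plus_i m d A)) z = (-1) ^ m * det (diag_plus_i m (\<lambda>i. d i - z) A)"
proof -
  have "- char_matrix (diag_plus_i m d A) z = (-1) \<cdot>\<^sub>m diag_plus_i m (\<lambda>i. d i - z) A"
    by (rule eq_matI) (auto simp: char_matrix_def diag_plus_i_index)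
  then show ?thesis
    by (simp add: char_poly_matrix[of _ m])
qed

text \<open>The identity is \<open>z I - A = i (- i z I + i A)\<close>. As
  \<open>Re (- \<i> * z) = Im z\<close>, the upper half-plane corresponds to diagonals with positive
  real part.\<close>

lemma poly_char_poly_of_real:
  assumes "A \<in> carrier_mat m m"
  shows "poly (map_poly complex_of_real (char_poly A)) z
    = \<i> ^ m * det (diag_plus_i m (\<lambda>_. - \<i> * z) A)"
proof -
  have "- char_matrix (map_mat complex_of_real A) z = \<i> \<cdot>\<^sub>m diag_plus_i m (\<lambda>_. - \<i> * z) A"
    using assms by (intro eq_matI) (auto simp: char_matrix_def diag_plus_i_index algebra_simps)
  then show ?thesis
    using assms by (simp add: char_poly_matrix[of _ m] flip: of_real_hom.char_poly_hom[OF assms])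
qed

section \<open>The matrices \<open>I_n + iA\<close>, \<open>A\<^sup>+\<close> and
  \<open>A_p\<close>\<close>

lemma In_plus_iA_eq: "In_plus_iA n A = diag_plus_i (Suc n) (\<lambda>i. if i = 0 then 0 else 1) A"
  by (rule eq_matI) (auto simp: In_plus_iA_def diag_plus_i_def)

lemma sym_mat_Aplus:
  assumes "sym_mat (Suc n) A"
  shows "sym_mat n (Aplus n A)"
  unfolding sym_mat_def by (auto simp: Aplus_def intro!: eq_matI sym_mat_index[OF assms])

lemma A_p_index:
  assumes "A \<in> carrier_mat (Suc n) (Suc n)" "i \<le> n" "j \<le> n"
  shows "A_p n A p $$ (i,j) = (if i = 0 then p else 1) * A $$ (i,j) * (if j = 0 then p else 1)"
proof -
  have 1: "(Ip n p * A) $$ (i,k) = (if i = 0 then p else 1) * A $$ (i,k)" if "k \<le> n" for k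
  proof -
    have "(Ip n p * A) $$ (i,k) = (\<Sum>l\<in>{0..<Suc n}. Ip n p $$ (i,l) * A $$ (l,k))"
      using assms that by (simp add: Ip_def scalar_prod_def)
    also have "\<dots> = (\<Sum>l\<in>{0..<Suc n}. if l = i then (if i = 0 then p else 1) * A $$ (i,k) else 0)"
      using assms by (intro sum.cong) (auto simp: Ip_def)
    also have "\<dots> = (if i = 0 then p else 1) * A $$ (i,k)"
      using assms by simp
    finally show ?thesis .
  qed
  have "A_p n A p $$ (i,j) = (\<Sum>l\<in>{0..<Suc n}. (Ip n p * A) $$ (i,l) * Ip n p $$ (l,j))"
    using assms by (simp add: A_p_def Ip_def scalar_prod_def)
  also have "\<dots> = (\<Sum>l\<in>{0..<Suc n}. if l = j then (Ip n p * A) $$ (i,j) * (if j = 0 then p else 1) else 0)"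
    using assms by (intro sum.cong) (auto simp: Ip_def)
  also have "\<dots> = (Ip n p * A) $$ (i,j) * (if j = 0 then p else 1)"
    using assms by simp
  finally show ?thesis
    using 1[OF assms(3)] by simp
qed

lemma A_p_carrier: "A \<in> carrier_mat (Suc n) (Suc n) \<Longrightarrow> A_p n A p \<in> carrier_mat (Suc n) (Suc n)"
  by (auto simp: A_p_def Ip_def)

lemma sym_mat_A_p:
  assumes "sym_mat (Suc n) A"
  shows "sym_mat (Suc n) (A_p n A p)"
proof -
  have A: "A \<in> carrier_mat (Suc n) (Suc n)" using assms by (simp add: sym_mat_def)
  note c = A_p_carrier[OF A, of p]
  show ?thesis
    unfolding sym_mat_def
  proof (intro conjI eq_matI)
    fix i j assume "i < dim_row (A_p n A p)" "j < dim_col (A_p n A p)"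
    then have ij: "i < Suc n" "j < Suc n" using c by auto
    then show "(A_p n A p)\<^sup>T $$ (i,j) = A_p n A p $$ (i,j)"
      using c sym_mat_index[OF assms ij] by (simp add: A_p_index[OF A])
  qed (use c in auto)
qed

lemma Aplus_A_p:
  assumes "A \<in> carrier_mat (Suc n) (Suc n)"
  shows "Aplus n (A_p n A p) = Aplus n A"
  using assms by (auto simp: Aplus_def A_p_index intro!: eq_matI)

text \<open>With \<open>d = (p\<^sup>-\<^sup>2,1,\<dots>,1)\<close>, the left-hand matrix is \<open>I\<^sub>n\<^sup>p (diag d + iA) I\<^sub>n\<^sup>p\<close>.\<close>

lemma det_diag_plus_i_A_p:
  assumes A: "A \<in> carrier_mat (Suc n) (Suc n)" and p: "p > 0"
  shows "det (diag_plus_i (Suc n) (\<lambda>_. 1) (A_p n A p)) = of_real (p\<^sup>2) *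
    det (diag_plus_i (Suc n) (\<lambda>i. if i = 0 then of_real (1 / p\<^sup>2) else 1) A)"
proof -
  let ?B = "diag_plus_i (Suc n) (\<lambda>i. if i = 0 then of_real (1 / p\<^sup>2) else 1) A"
  \<comment> \<open>Scaling column 0 is expressed as scaling row 0 of the transpose. The corner is
    scaled twice, which turns \<open>1 / p\<^sup>2\<close> into 1.\<close>
  have "diag_plus_i (Suc n) (\<lambda>_. 1) (A_p n A p)
      = multrow 0 (of_real p) (multrow 0 (of_real p) ?B\<^sup>T)\<^sup>T"
    using A p
    by (intro eq_matI)
       (auto simp: diag_plus_i_index A_p_index less_Suc_eq_le power2_eq_square field_simps)
  also have "det \<dots> = of_real p * det (multrow 0 (of_real p) ?B\<^sup>T)\<^sup>T"
    by (rule det_multrow) auto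
  also have "det (multrow 0 (of_real p) ?B\<^sup>T)\<^sup>T = det (multrow 0 (of_real p) ?B\<^sup>T)"
    by (rule det_transpose) auto
  also have "\<dots> = of_real p * det ?B\<^sup>T"
    by (rule det_multrow) auto
  also have "det ?B\<^sup>T = det ?B"
    by (rule det_transpose) auto
  finally show ?thesis
    by (simp add: power2_eq_square)
qed

section \<open>Principal minors and the characteristic polynomial\<close>

lemma bij_betw_pick:
  assumes "finite S"
  shows "bij_betw (pick S) {0..<card S} S"
proof -
  have inj: "inj_on (pick S) {0..<card S}"
    using pick_mono_le[of _ S] by (intro linorder_inj_onI) (auto simp: less_le)
  have "pick S ` {0..<card S} \<subseteq> S"
    using pick_in_set_le by auto
  then have "pick S ` {0..<card S} = S"
    using assms inj by (intro card_subset_eq) (auto simp: card_image)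
  with inj show ?thesis by (simp add: bij_betw_def)
qed

text \<open>This is the Leibniz formula indexed by permutations of \<open>S\<close> itself instead
  of positions. Transport along the enumeration \<open>pick S\<close> is a bijection of permutations
  that preserves signs.\<close>

lemma det_principal_submatrix:
  fixes A :: "'a :: comm_ring_1 mat"
  assumes A: "A \<in> carrier_mat m m" and S: "S \<subseteq> {0..<m}"
  shows "det (submatrix A S S) = (\<Sum>p | p permutes S. signof p * (\<Prod>i\<in>S. A $$ (i, p i)))"
proof -
  define k where "k = card S"
  define I where "I = {0..<k}"
  have finS: "finite S" using S finite_subset by blast
  have bij: "bij_betw (pick S) I S"
    unfolding I_def k_def using bij_betw_pick[OF finS] .
  then have inj: "inj_on (pick S) I" by (simp add: bij_betw_def)
  have [simp]: "{i. i < m \<and> i \<in> S} = S" using S by auto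
  have sub: "submatrix A S S \<in> carrier_mat k k"
    using A by (auto simp: dim_submatrix k_def)
  have ind: "submatrix A S S $$ (i,j) = A $$ (pick S i, pick S j)" if "i \<in> I" "j \<in> I" for i j
    using that A by (intro submatrix_index) (auto simp: k_def I_def)
  let ?h = "map_permutation I (pick S)"
  have h: "?h = (\<lambda>p x. if x \<in> S then pick S (p (inv_into I (pick S) x)) else x)"
    using bij by (auto simp: fun_eq_iff map_permutation_def restrict_id_def bij_betw_def)
  have bij_h: "bij_betw ?h {p. p permutes I} {p. p permutes S}"
    unfolding h by (rule bij_betw_permutations[OF bij])
  have "det (submatrix A S S) =
      (\<Sum>p | p permutes I. signof p * (\<Prod>i\<in>I. submatrix A S S $$ (i, p i)))"
    unfolding I_def by (rule det_def'[OF sub])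
  also have "\<dots> = (\<Sum>p | p permutes I. signof (?h p) * (\<Prod>i\<in>S. A $$ (i, ?h p i)))"
  proof (intro sum.cong refl)
    fix p assume "p \<in> {p. p permutes I}"
    then have p: "p permutes I" by simp
    have "(\<Prod>i\<in>S. A $$ (i, ?h p i)) = (\<Prod>i\<in>I. A $$ (pick S i, ?h p (pick S i)))"
      by (rule prod.reindex_bij_betw[OF bij, symmetric])
    also have "\<dots> = (\<Prod>i\<in>I. submatrix A S S $$ (i, p i))"
      using inj permutes_in_image[OF p] by (intro prod.cong) (auto simp: map_permutation_apply ind)
    finally show "signof p * (\<Prod>i\<in>I. submatrix A S S $$ (i, p i)) =
        signof (?h p) * (\<Prod>i\<in>S. A $$ (i, ?h p i))"
      using sign_map_permutation[OF inj p] by (simp add: I_def)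
  qed
  also have "\<dots> = (\<Sum>p | p permutes S. signof p * (\<Prod>i\<in>S. A $$ (i, p i)))"
    by (rule sum.reindex_bij_betw[OF bij_h])
  finally show ?thesis .
qed

text \<open>In the Leibniz formula each product is expanded over the set \<open>S\<close> of rows
  from which the entry of \<open>A\<close> is taken. The other rows give a nonzero contribution only
  if the permutation fixes them, that is, if it permutes \<open>S\<close>.\<close>

lemma det_add_smult_one:
  fixes A :: "'a :: comm_ring_1 mat"
  assumes A: "A \<in> carrier_mat m m"
  shows "det (A + x \<cdot>\<^sub>m 1\<^sub>m m) = (\<Sum>S\<in>Pow {0..<m}. x ^ (m - card S) * det (submatrix A S S))"
proof -
  let ?M = "{0..<m}"
  have prod_diag: "(\<Prod>i\<in>?M - S. if p i = i then x else 0) =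
      (if p permutes S then x ^ (m - card S) else 0)"
    if S: "S \<in> Pow ?M" and p: "p permutes ?M" for S p
  proof (cases "p permutes S")
    case True
    then have "(\<Prod>i\<in>?M - S. if p i = i then x else 0) = (\<Prod>i\<in>?M - S. x)"
      by (intro prod.cong) (auto simp: permutes_not_in)
    also have "\<dots> = x ^ (m - card S)"
      using S finite_subset[of S ?M] by (simp add: card_Diff_subset)
    finally show ?thesis using True by simp
  next
    case False
    then have "\<exists>i\<in>?M - S. p i \<noteq> i"
      using permutes_superset[OF p] by blast
    then have "(\<Prod>i\<in>?M - S. if p i = i then x else 0) = 0"
      by (intro prod_zero) auto
    with False show ?thesis by simp
  qed
  have "det (A + x \<cdot>\<^sub>m 1\<^sub>m m) = (\<Sum>p | p permutes ?M. signof p *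
      (\<Prod>i\<in>?M. (A + x \<cdot>\<^sub>m 1\<^sub>m m) $$ (i, p i)))"
    using A by (intro det_def') auto
  also have "\<dots> = (\<Sum>p | p permutes ?M. signof p *
      (\<Prod>i\<in>?M. A $$ (i, p i) + (if p i = i then x else 0)))"
  proof (intro sum.cong refl arg_cong2[where f = times] prod.cong)
    fix p i assume "p \<in> {p. p permutes ?M}" "i \<in> ?M"
    then have "p i < m" "i < m" using permutes_in_image[of p ?M i] by auto
    then show "(A + x \<cdot>\<^sub>m 1\<^sub>m m) $$ (i, p i) = A $$ (i, p i) + (if p i = i then x else 0)"
      using A by auto
  qed
  also have "\<dots> = (\<Sum>p | p permutes ?M. \<Sum>S\<in>Pow ?M.
      if p permutes S then x ^ (m - card S) * (signof p * (\<Prod>i\<in>S. A $$ (i, p i))) else 0)"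
    by (intro sum.cong refl)
       (auto simp: prod_add sum_distrib_left prod_diag mult_ac intro!: sum.cong)
  also have "\<dots> = (\<Sum>S\<in>Pow ?M. \<Sum>p | p permutes ?M.
      if p permutes S then x ^ (m - card S) * (signof p * (\<Prod>i\<in>S. A $$ (i, p i))) else 0)"
    by (rule sum.swap)
  also have "\<dots> = (\<Sum>S\<in>Pow ?M. x ^ (m - card S) * det (submatrix A S S))"
  proof (intro sum.cong refl)
    fix S assume S: "S \<in> Pow ?M"
    have "(\<Sum>p | p permutes ?M.
        if p permutes S then x ^ (m - card S) * (signof p * (\<Prod>i\<in>S. A $$ (i, p i))) else 0)
      = (\<Sum>p | p permutes S. x ^ (m - card S) * (signof p * (\<Prod>i\<in>S. A $$ (i, p i))))"
      using S permutes_subset[of _ S ?M]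
      by (intro sum.mono_neutral_cong_right) (auto intro: finite_permutations)
    then show "(\<Sum>p | p permutes ?M.
        if p permutes S then x ^ (m - card S) * (signof p * (\<Prod>i\<in>S. A $$ (i, p i))) else 0)
      = x ^ (m - card S) * det (submatrix A S S)"
      using S by (simp add: det_principal_submatrix[OF A] sum_distrib_left)
  qed
  finally show ?thesis .
qed

lemma det_add_smult_one_sigma:
  assumes A: "A \<in> carrier_mat m m"
  shows "det (A + x \<cdot>\<^sub>m 1\<^sub>m m) = (\<Sum>i\<le>m. x ^ i * sigma (m - i) A)"
proof -
  have "det (A + x \<cdot>\<^sub>m 1\<^sub>m m) = (\<Sum>j\<le>m. \<Sum>S | S \<in> Pow {0..<m} \<and> card S = j.
      x ^ (m - card S) * det (submatrix A S S))"
    unfolding det_add_smult_one[OF A]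
    using card_mono[of "{0..<m}"] by (intro sum.group[symmetric]) auto
  also have "\<dots> = (\<Sum>j\<le>m. x ^ (m - j) * sigma j A)"
    using A by (intro sum.cong refl) (auto simp: sigma_def sum_distrib_left intro!: sum.cong)
  also have "\<dots> = (\<Sum>i\<le>m. x ^ i * sigma (m - i) A)"
    by (rule sum.reindex_bij_witness[of _ "\<lambda>i. m - i" "\<lambda>i. m - i"]) auto
  finally show ?thesis .
qed

lemma sigma_0: "sigma 0 A = 1"
proof -
  have "{S. S \<subseteq> {0..<dim_row A} \<and> card S = 0} = {{}}"
    using finite_subset[of _ "{0..<dim_row A}"] by auto
  moreover have "det (submatrix A {} {}) = 1"
    by (rule det_dim_zero) (auto simp: submatrix_def)
  ultimately show ?thesis by (simp add: sigma_def)
qed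

lemma sigma_eq_0:
  assumes "dim_row A < j"
  shows "sigma j A = 0"
proof -
  have "card S \<noteq> j" if "S \<subseteq> {0..<dim_row A}" for S
    using card_mono[OF _ that] assms by auto
  then show ?thesis unfolding sigma_def by (intro sum.neutral) auto
qed

lemma sigma_1:
  assumes A: "A \<in> carrier_mat m m"
  shows "sigma 1 A = (\<Sum>i<m. A $$ (i,i))"
proof -
  have "{S. S \<subseteq> {0..<dim_row A} \<and> card S = 1} = (\<lambda>i. {i}) ` {..<m}"
    using A by (auto simp: card_1_singleton_iff)
  then have "sigma 1 A = (\<Sum>i<m. det (submatrix A {i} {i}))"
    by (simp add: sigma_def sum.reindex)
  also have "\<dots> = (\<Sum>i<m. A $$ (i,i))"
  proof (intro sum.cong refl)
    fix i assume "i \<in> {..<m}"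
    then show "det (submatrix A {i} {i}) = A $$ (i,i)"
      by (subst det_principal_submatrix[OF A]) auto
  qed
  finally show ?thesis .
qed

lemma det_principal_submatrix_doubleton:
  fixes A :: "'a :: comm_ring_1 mat"
  assumes A: "A \<in> carrier_mat m m" and ij: "i < m" "j < m" "i \<noteq> j"
  shows "det (submatrix A {i,j} {i,j}) = A $$ (i,i) * A $$ (j,j) - A $$ (i,j) * A $$ (j,i)"
proof -
  have "{p. p permutes {i,j}} = {id, Transposition.transpose i j}"
    by (auto simp: permutes_doubleton_iff)
  moreover have "id \<noteq> Transposition.transpose i j"
    using ij by (metis id_apply transpose_apply_first)
  ultimately show ?thesis
    using ij by (subst det_principal_submatrix[OF A]) (auto simp: sign_swap_id)
qed

section \<open>The coefficients \<open>rho\<close> and the polynomial \<open>chi_inf\<close>\<close>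

text \<open>The two branches of \<open>rho\<close> merge, because \<open>Aplus n A\<close> has size
  \<open>n\<close> and so no minors of size \<open>n + 1\<close>.\<close>

lemma rho_eq:
  assumes "i \<le> n + 1"
  shows "rho n i A = sigma i A - sigma i (Aplus n A)"
  using assms by (auto simp: rho_def sigma_eq_0 Aplus_def le_Suc_eq)

text \<open>A difference of traces; it gives the coefficient of degree \<open>n\<close> in
  \<open>chi_inf\<close>.\<close>

lemma rho_1:
  assumes A: "A \<in> carrier_mat (Suc n) (Suc n)"
  shows "rho n 1 A = A $$ (0,0)"
proof -
  have "sigma 1 (Aplus n A) = (\<Sum>i<n. Aplus n A $$ (i,i))"
    by (rule sigma_1) (auto simp: Aplus_def)
  also have "\<dots> = (\<Sum>i<n. A $$ (Suc i, Suc i))"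
    by (intro sum.cong) (auto simp: Aplus_def)
  finally show ?thesis
    by (simp only: rho_eq sigma_1[OF A] sum.lessThan_Suc_shift)
qed

text \<open>The minors on pairs avoiding the index 0 are those of \<open>Aplus n A\<close> and
  cancel. What remains gives the leading coefficient of \<open>chi_inf\<close> when the corner entry
  is 0.\<close>

lemma rho_2:
  assumes A: "A \<in> carrier_mat (Suc n) (Suc n)" and n: "n \<ge> 1"
  shows "rho n 2 A = (\<Sum>j<n. A $$ (0,0) * A $$ (Suc j, Suc j) - A $$ (0, Suc j) * A $$ (Suc j, 0))"
proof -
  let ?P = "{S. S \<subseteq> {0..<Suc n} \<and> card S = 2}"
  let ?Z = "(\<lambda>j. {0, Suc j}) ` {..<n}"
  let ?Q = "{S. S \<subseteq> {0..<n} \<and> card S = 2}"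
  let ?R = "(\<lambda>S. Suc ` S) ` ?Q"
  have Ap: "Aplus n A \<in> carrier_mat n n" by (simp add: Aplus_def)
  have injZ: "inj_on (\<lambda>j. {0, Suc j}) {..<n}"
    by (rule inj_onI) (simp add: doubleton_eq_iff)
  have injR: "inj_on (\<lambda>S. Suc ` S) ?Q"
    by (rule inj_onI) (simp add: inj_image_eq_iff)
  have "?P = ?Z \<union> ?R"
  proof (intro equalityI subsetI)
    fix S assume "S \<in> ?P"
    then obtain x y where xy: "S = {x,y}" "x \<noteq> y" "x < Suc n" "y < Suc n"
      by (auto simp: card_2_iff)
    then have "S = {min x y, max x y}" "min x y < max x y" "max x y < Suc n"
      by (auto simp: min_def max_def)
    then obtain i j where S: "S = {i,j}" "i < j" "j < Suc n" by blast
    show "S \<in> ?Z \<union> ?R"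
    proof (cases i)
      case 0
      with S show ?thesis by (cases j) auto
    next
      case (Suc i')
      with S obtain j' where "j = Suc j'" by (cases j) auto
      with Suc S have "S = Suc ` {i', j'}" "{i', j'} \<in> ?Q" by auto
      then show ?thesis by blast
    qed
  next
    fix S assume "S \<in> ?Z \<union> ?R"
    then consider j where "j < n" "S = {0, Suc j}" | T where "T \<in> ?Q" "S = Suc ` T" by blast
    then show "S \<in> ?P" by cases (auto simp: card_image)
  qed
  moreover have "?Z \<inter> ?R = {}" by auto
  moreover have "finite ?Z" "finite ?R" by (auto intro: finite_subset[of _ "Pow {0..<n}"])
  ultimately have "sigma 2 A = (\<Sum>S\<in>?Z. det (submatrix A S S)) + (\<Sum>S\<in>?R. det (submatrix A S S))"
    using A by (simp add: sigma_def sum.union_disjoint)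
  also have "(\<Sum>S\<in>?Z. det (submatrix A S S)) = (\<Sum>j<n. det (submatrix A {0, Suc j} {0, Suc j}))"
    by (rule sum.reindex[OF injZ, unfolded o_def])
  also have "\<dots> = (\<Sum>j<n. A $$ (0,0) * A $$ (Suc j, Suc j) - A $$ (0, Suc j) * A $$ (Suc j, 0))"
    using A by (intro sum.cong refl det_principal_submatrix_doubleton) auto
  also have "(\<Sum>S\<in>?R. det (submatrix A S S)) = (\<Sum>S\<in>?Q. det (submatrix A (Suc ` S) (Suc ` S)))"
    by (rule sum.reindex[OF injR, unfolded o_def])
  also have "\<dots> = sigma 2 (Aplus n A)"
  proof -
    have "det (submatrix A (Suc ` S) (Suc ` S)) = det (submatrix (Aplus n A) S S)" if "S \<in> ?Q" for S
    proof -
      from that obtain i j where S: "S = {i,j}" "i \<noteq> j" "i < n" "j < n" by (auto simp: card_2_iff)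
      then show ?thesis
        using det_principal_submatrix_doubleton[OF A, of "Suc i" "Suc j"]
          det_principal_submatrix_doubleton[OF Ap, of i j]
        by (simp add: Aplus_def)
    qed
    then show ?thesis by (simp add: sigma_def Aplus_def)
  qed
  finally show ?thesis
    using n by (simp add: rho_eq)
qed

lemma coeff_chi_inf: "coeff (chi_inf n A) i = (if i \<le> n then (-1) ^ i * rho n (n + 1 - i) A else 0)"
proof -
  have "[:0, -1 :: real:] ^ k = monom ((-1) ^ k) k" for k :: nat
    by (induction k) (simp_all add: monom_0 monom_Suc one_pCons smult_monom)
  then have "chi_inf n A = (\<Sum>i\<le>n. monom ((-1) ^ i * rho n (n + 1 - i) A) i)"
    by (simp add: chi_inf_def smult_monom mult_ac)
  then show ?thesis
    by (simp add: coeff_sum)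
qed

text \<open>Both determinants \<open>det (A - x I)\<close> and \<open>det (A\<^sup>+ - x I)\<close>
  are generating functions of the \<open>sigma\<close>, and multiplying the second by
  \<open>- x\<close> aligns the powers so that the coefficients subtract to
  \<open>rho\<close>.\<close>

lemma chi_inf_eq:
  assumes A: "A \<in> carrier_mat (Suc n) (Suc n)"
  shows "chi_inf n A = Polynomial.smult ((-1) ^ Suc n) (char_poly A - [:0, 1:] * char_poly (Aplus n A))"
proof (subst poly_eq_poly_eq_iff[symmetric], rule ext)
  fix x :: real
  have Ap: "Aplus n A \<in> carrier_mat n n" by (simp add: Aplus_def)
  have cp: "det (M + (- x) \<cdot>\<^sub>m 1\<^sub>m m) = (-1) ^ m * poly (char_poly M) x"
    if "M \<in> carrier_mat m m" for m and M :: "real mat"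
  proof -
    have "M + (- x) \<cdot>\<^sub>m 1\<^sub>m m = (-1) \<cdot>\<^sub>m (- char_matrix M x)"
      using that by (intro eq_matI) (auto simp: char_matrix_def)
    then show ?thesis
      using carrier_matD(2)[OF char_matrix_closed[OF that]] by (simp add: char_poly_matrix[OF that])
  qed
  have 1: "det (A + (- x) \<cdot>\<^sub>m 1\<^sub>m (Suc n)) =
      sigma (Suc n) A + (\<Sum>i\<le>n. (- x) ^ Suc i * sigma (n - i) A)"
    unfolding det_add_smult_one_sigma[OF A] by (subst sum.atMost_Suc_shift) simp
  have 2: "(- x) * det (Aplus n A + (- x) \<cdot>\<^sub>m 1\<^sub>m n) = (\<Sum>i\<le>n. (- x) ^ Suc i * sigma (n - i) (Aplus n A))"
    unfolding det_add_smult_one_sigma[OF Ap] by (simp add: sum_distrib_left mult_ac)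
  have "poly (chi_inf n A) x = (\<Sum>i\<le>n. (- x) ^ i * rho n (Suc n - i) A)"
    by (simp add: chi_inf_def poly_sum mult_ac)
  \<comment> \<open>The added top term is 0, since both \<open>sigma 0\<close> are 1.\<close>
  also have "\<dots> = (\<Sum>i\<le>Suc n. (- x) ^ i * rho n (Suc n - i) A)"
    by (simp add: rho_eq sigma_0)
  also have "\<dots> = rho n (Suc n) A + (\<Sum>i\<le>n. (- x) ^ Suc i * rho n (n - i) A)"
    by (subst sum.atMost_Suc_shift) simp
  also have "\<dots> = det (A + (- x) \<cdot>\<^sub>m 1\<^sub>m (Suc n)) - (- x) * det (Aplus n A + (- x) \<cdot>\<^sub>m 1\<^sub>m n)"
    unfolding 1 2
    by (simp add: rho_eq sigma_eq_0 carrier_matD[OF Ap] right_diff_distrib sum_subtractf sum_negf)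
  also have "\<dots> = poly (Polynomial.smult ((-1) ^ Suc n)
      (char_poly A - [:0, 1:] * char_poly (Aplus n A))) x"
    unfolding cp[OF A] cp[OF Ap] by (simp add: algebra_simps)
  finally show "poly (chi_inf n A) x = poly (Polynomial.smult ((-1) ^ Suc n)
      (char_poly A - [:0, 1:] * char_poly (Aplus n A))) x" .
qed

section \<open>The three argument sums\<close>

lemma char_poly_sym_mat_no_nonreal_roots:
  assumes M: "sym_mat m M" and "Im z > 0"
  shows "poly (map_poly complex_of_real (char_poly M)) z \<noteq> 0"
  using assms det_diag_plus_i_nonzero[OF M, of "\<lambda>_. - \<i> * z"]
  by (subst poly_char_poly_of_real[of _ m]) (auto simp: sym_mat_def)

lemma char_poly_nonzero: "M \<in> carrier_mat m m \<Longrightarrow> char_poly M \<noteq> 0"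
  using degree_monic_char_poly[of M m] by auto

text \<open>If \<open>p\<close> is the characteristic polynomial of a symmetric \<open>M\<close>,
  these are the eigenvalues of the identity plus \<open>\<i> M\<close>; each has argument
  \<open>arctan x\<close>.\<close>

definition shifted_roots :: "real poly \<Rightarrow> complex multiset" where
  "shifted_roots p = image_mset (\<lambda>x. 1 + \<i> * of_real x) (proots p)"

lemma shifted_roots_Re: "x \<in># shifted_roots p \<Longrightarrow> Re x \<ge> 0 \<and> x \<noteq> 0"
  by (auto simp: shifted_roots_def complex_eq_iff)

lemma sum_Arg_shifted_roots: "(\<Sum>x\<in>#shifted_roots p. Arg x) = (\<Sum>x\<in>#proots p. arctan x)"
  by (simp add: shifted_roots_def image_mset.compositionality o_def arg_conv_arctan)

text \<open>Each linear factor is \<open>i (1 + s) - x = i (1 + i x + s)\<close>, so a factor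
  \<open>\<i>\<close> comes out once per root.\<close>

lemma poly_eval_imaginary:
  fixes p :: "real poly"
  assumes "p \<noteq> 0" "\<And>z::complex. Im z > 0 \<Longrightarrow> poly (map_poly of_real p) z \<noteq> 0"
  shows "poly (map_poly complex_of_real p) (\<i> * of_real (1 + s)) =
    of_real (lead_coeff p) * \<i> ^ degree p * (\<Prod>x\<in>#shifted_roots p. x + of_real s)"
proof -
  have "(\<Prod>x\<in>#X. \<i> * of_real (1 + s) - of_real x)
      = \<i> ^ size X * (\<Prod>x\<in>#X. 1 + \<i> * of_real x + of_real s)" for X
    by (induction X) (auto simp: algebra_simps)
  from this[of "proots p"] show ?thesis
    using real_rooted_poly_eval[OF assms]
    by (simp add: shifted_roots_def image_mset.compositionality o_def mult_ac)
qed

lemma det_diag_plus_i_sym_mat: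
  assumes M: "sym_mat m M"
  shows "det (diag_plus_i m (\<lambda>_. of_real (1 + s)) M)
    = (\<Prod>x\<in>#shifted_roots (char_poly M). x + of_real s)"
proof -
  have c: "M \<in> carrier_mat m m" using M by (simp add: sym_mat_def)
  have "\<i> ^ m * det (diag_plus_i m (\<lambda>_. of_real (1 + s)) M)
      = poly (map_poly complex_of_real (char_poly M)) (\<i> * of_real (1 + s))"
    unfolding poly_char_poly_of_real[OF c] by (simp add: mult.assoc[symmetric])
  also have "\<dots> = \<i> ^ m * (\<Prod>x\<in>#shifted_roots (char_poly M). x + of_real s)"
    using degree_monic_char_poly[OF c] char_poly_nonzero[OF c]
      char_poly_sym_mat_no_nonreal_roots[OF M]
    by (subst poly_eval_imaginary) auto
  finally show ?thesis by simp
qed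

text \<open>The common form of the three computations: the function \<open>\<delta>\<close> is the
  path of the corner entry, while the lower block always follows \<open>1 + s\<close>, so the
  denominator of the pivot is the same each time and supplies
  \<open>tr_arctan (Aplus n A)\<close>.\<close>

lemma sum_Arg_bordered:
  fixes \<delta> :: "real \<Rightarrow> real"
  assumes A: "sym_mat (Suc n) A"
    and X: "\<And>x. x \<in># X \<Longrightarrow> Re x \<ge> 0 \<and> x \<noteq> 0"
    and c: "c \<noteq> 0" "Re c \<ge> 0"
    and \<delta>: "\<And>s. s \<ge> 0 \<Longrightarrow> \<delta> s \<ge> 0"
    and det: "\<And>s. s \<ge> 0 \<Longrightarrow>
      det (diag_plus_i (Suc n) (\<lambda>i. if i = 0 then of_real (\<delta> s) else of_real (1 + s)) A)
        = c * (\<Prod>x\<in>#X. x + of_real s)"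
  shows "Arg c + (\<Sum>x\<in>#X. Arg x) = tr_arctan (Aplus n A)
    + Arg (det (diag_plus_i (Suc n) (\<lambda>i. if i = 0 then of_real (\<delta> 0) else 1) A)
        / det (diag_plus_i n (\<lambda>_. 1) (Aplus n A)))"
proof -
  let ?Y = "shifted_roots (char_poly (Aplus n A))"
  note detY = det_diag_plus_i_sym_mat[OF sym_mat_Aplus[OF A]]
  have "Arg (c * \<Prod>\<^sub># X / \<Prod>\<^sub># ?Y) = Arg c + (\<Sum>x\<in>#X. Arg x) - (\<Sum>y\<in>#?Y. Arg y)"
  proof (rule Arg_prod_quotient[OF X shifted_roots_Re c])
    fix s :: real assume s: "s \<ge> 0"
    show "0 \<le> Re (c * (\<Prod>x\<in>#X. x + of_real s) / (\<Prod>y\<in>#?Y. y + of_real s))"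
      unfolding det[OF s, symmetric] detY[symmetric]
      using Re_det_diag_plus_i_divide_minor[OF A,
          of "\<lambda>i. if i = 0 then of_real (\<delta> s) else of_real (1 + s)"] \<delta>[OF s] s
      by simp
  qed
  then show ?thesis
    using det[of 0] detY[of 0] by (simp add: sum_Arg_shifted_roots tr_arctan_def cong: if_cong)
qed

text \<open>With corner path \<open>s\<close>, the whole diagonal is shifted by \<open>s\<close>,
  and the determinant factors over the eigenvalues of \<open>I_n + iA\<close>.\<close>

lemma Theta_hat_eq:
  assumes A: "sym_mat (Suc n) A" and nz: "\<exists>j\<le>n. A $$ (0,j) \<noteq> 0"
  shows "Theta_hat n A = tr_arctan (Aplus n A)
    + Arg (det (diag_plus_i (Suc n) (\<lambda>i. if i = 0 then 0 else 1) A)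
        / det (diag_plus_i n (\<lambda>_. 1) (Aplus n A)))"
proof -
  let ?M = "diag_plus_i (Suc n) (\<lambda>i. if i = 0 then 0 else 1) A"
  have M: "?M \<in> carrier_mat (Suc n) (Suc n)" by simp
  have cp: "lead_coeff (char_poly ?M) = 1" "degree (char_poly ?M) = Suc n"
    using degree_monic_char_poly[OF M] by auto
  have "Arg 1 + (\<Sum>x\<in>#proots (char_poly ?M). Arg x) = tr_arctan (Aplus n A)
    + Arg (det (diag_plus_i (Suc n) (\<lambda>i. if i = 0 then of_real 0 else 1) A)
        / det (diag_plus_i n (\<lambda>_. 1) (Aplus n A)))"
  proof (rule sum_Arg_bordered[OF A, where \<delta> = "\<lambda>s. s"])
    fix x assume "x \<in># proots (char_poly ?M)"
    then have "poly (char_poly ?M) x = 0"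
      using char_poly_nonzero[OF M] by simp
    then have *: "det (diag_plus_i (Suc n) (\<lambda>i. (if i = 0 then 0 else 1) - x) A) = 0"
      by (simp add: poly_char_poly_diag_plus_i)
    show "0 \<le> Re x \<and> x \<noteq> 0"
    proof (rule ccontr)
      \<comment> \<open>If \<open>Re x < 0\<close>, all diagonal entries have positive real part; if
        \<open>x = 0\<close>, the corner is 0 and \<open>nz\<close> supplies the nonzero entry in
        row 0.\<close>
      assume "\<not> (0 \<le> Re x \<and> x \<noteq> 0)"
      then have "det (diag_plus_i (Suc n) (\<lambda>i. (if i = 0 then 0 else 1) - x) A) \<noteq> 0"
        using nz by (intro det_diag_plus_i_nonzero[OF A]) (auto simp: less_Suc_eq_le)
      with * show False by simp
    qed
  next
    fix s :: real assume "s \<ge> 0"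
    have prod: "poly (\<Prod>x\<in>#Z. [:- x, 1:]) (- of_real s) = (-1) ^ size Z * (\<Prod>x\<in>#Z. x + of_real s)"
      for Z :: "complex multiset"
      by (induction Z) (auto simp: algebra_simps)
    have "char_poly ?M = (\<Prod>x\<in>#proots (char_poly ?M). [:- x, 1:])"
      using complex_poly_decompose_multiset[of "char_poly ?M", unfolded cp(1)] by simp
    then have "poly (char_poly ?M) (- of_real s)
        = poly (\<Prod>x\<in>#proots (char_poly ?M). [:- x, 1:]) (- of_real s)"
      by (rule arg_cong)
    also have "\<dots> = (-1) ^ Suc n * (\<Prod>x\<in>#proots (char_poly ?M). x + of_real s)"
      unfolding prod size_proots_complex cp(2) ..
    finally have "poly (char_poly ?M) (- of_real s)
        = (-1) ^ Suc n * (\<Prod>x\<in>#proots (char_poly ?M). x + of_real s)" .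
    moreover have "poly (char_poly ?M) (- of_real s) = (-1) ^ Suc n *
        det (diag_plus_i (Suc n) (\<lambda>i. if i = 0 then of_real s else of_real (1 + s)) A)"
      unfolding poly_char_poly_diag_plus_i
      by (intro arg_cong2[where f = times] refl arg_cong[where f = det])
         (auto simp: diag_plus_i_def)
    ultimately show "det (diag_plus_i (Suc n) (\<lambda>i. if i = 0 then of_real s else of_real (1 + s)) A)
        = 1 * (\<Prod>x\<in>#proots (char_poly ?M). x + of_real s)"
      by simp
  qed auto
  then show ?thesis
    by (simp add: Theta_hat_def In_plus_iA_eq cong: if_cong)
qed

text \<open>The corner path is \<open>1 + s\<close>, applied to \<open>A_p\<close>, which has the
  same lower block as \<open>A\<close>. Its pivot is \<open>p\<^sup>2\<close> times the displayed
  one, and a positive factor leaves \<open>Arg\<close> unchanged.\<close>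

lemma tr_arctan_A_p:
  assumes A: "sym_mat (Suc n) A" and p: "p > 0"
  shows "tr_arctan (A_p n A p) = tr_arctan (Aplus n A)
    + Arg (det (diag_plus_i (Suc n) (\<lambda>i. if i = 0 then 0 else 1) A)
        / det (diag_plus_i n (\<lambda>_. 1) (Aplus n A)) + of_real (1 / p\<^sup>2))"
proof -
  let ?D = "det (diag_plus_i n (\<lambda>_. 1) (Aplus n A))"
  have Ac: "A \<in> carrier_mat (Suc n) (Suc n)" using A by (simp add: sym_mat_def)
  have "?D \<noteq> 0"
    by (intro det_diag_plus_i_nonzero sym_mat_Aplus A) auto
  have "det (diag_plus_i (Suc n) (\<lambda>i. if i = 0 then of_real (1 / p\<^sup>2) else 1) A)
      = det (diag_plus_i (Suc n) (\<lambda>i. if i = 0 then 0 else 1) A) + of_real (1 / p\<^sup>2) * ?D"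
    by (subst det_diag_plus_i_split) (simp add: fun_upd_def if_distrib cong: if_cong)
  then have piv: "det (diag_plus_i (Suc n) (\<lambda>_. 1) (A_p n A p)) / ?D =
      of_real (p\<^sup>2) * (det (diag_plus_i (Suc n) (\<lambda>i. if i = 0 then 0 else 1) A) / ?D + of_real (1 / p\<^sup>2))"
    using \<open>?D \<noteq> 0\<close> by (simp add: det_diag_plus_i_A_p[OF Ac p] field_simps del: of_real_power of_real_divide)
  have "Arg 1 + (\<Sum>x\<in>#shifted_roots (char_poly (A_p n A p)). Arg x) = tr_arctan (Aplus n (A_p n A p))
    + Arg (det (diag_plus_i (Suc n) (\<lambda>i. if i = 0 then of_real (1 + 0) else 1) (A_p n A p))
        / det (diag_plus_i n (\<lambda>_. 1) (Aplus n (A_p n A p))))"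
  proof (rule sum_Arg_bordered[OF sym_mat_A_p[OF A] shifted_roots_Re, where \<delta> = "\<lambda>s. 1 + s"])
    fix s :: real
    show "det (diag_plus_i (Suc n) (\<lambda>i. if i = 0 then of_real (1 + s) else of_real (1 + s)) (A_p n A p))
        = 1 * (\<Prod>x\<in>#shifted_roots (char_poly (A_p n A p)). x + of_real s)"
      using det_diag_plus_i_sym_mat[OF sym_mat_A_p[OF A], of s] by simp
  qed auto
  then show ?thesis
    using p by (simp add: sum_Arg_shifted_roots tr_arctan_def Aplus_A_p[OF Ac] piv
        del: of_real_power of_real_divide cong: if_cong)
qed

text \<open>In other words, \<open>chi_inf\<close> at \<open>z\<close> is
  \<open>det (A - z I_n)\<close>: subtracting \<open>z\<close> times the minor removes the spectral
  parameter from the corner.\<close>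

lemma poly_chi_inf:
  assumes A: "A \<in> carrier_mat (Suc n) (Suc n)"
  shows "poly (map_poly complex_of_real (chi_inf n A)) z
    = (- \<i>) ^ Suc n * det (diag_plus_i (Suc n) (\<lambda>i. if i = 0 then 0 else - \<i> * z) A)"
proof -
  interpret map_poly_comm_ring_hom complex_of_real
    by unfold_locales auto
  have Ap: "Aplus n A \<in> carrier_mat n n" by (simp add: Aplus_def)
  have split: "det (diag_plus_i (Suc n) (\<lambda>_. - \<i> * z) A) =
      det (diag_plus_i (Suc n) (\<lambda>i. if i = 0 then 0 else - \<i> * z) A)
      + (- \<i> * z) * det (diag_plus_i n (\<lambda>_. - \<i> * z) (Aplus n A))"
    by (subst det_diag_plus_i_split) (simp add: fun_upd_def cong: if_cong)
  have "poly (map_poly complex_of_real (chi_inf n A)) z = (-1) ^ Suc n *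
      (poly (map_poly complex_of_real (char_poly A)) z
       - z * poly (map_poly complex_of_real (char_poly (Aplus n A))) z)"
    by (simp add: chi_inf_eq[OF A] hom_distribs)
  also have "\<dots> = (-1) ^ Suc n * \<i> ^ Suc n *
      det (diag_plus_i (Suc n) (\<lambda>i. if i = 0 then 0 else - \<i> * z) A)"
    unfolding poly_char_poly_of_real[OF A] poly_char_poly_of_real[OF Ap] split
    by (simp add: algebra_simps)
  also have "(-1) ^ Suc n * \<i> ^ Suc n = (- \<i>) ^ Suc n"
    by (simp flip: power_mult_distrib)
  finally show ?thesis .
qed

lemma degree_eqI_coeff:
  assumes "coeff p k \<noteq> 0" "\<And>i. i > k \<Longrightarrow> coeff p i = 0"
  shows "degree p = k"
  using assms by (intro antisym degree_le le_degree) auto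

text \<open>If the corner entry is 0, the top coefficient vanishes and the next one is, up to sign,
  \<open>rho n 2 A\<close>, minus the sum of the squares of row 0. The sign of the leading
  coefficient later decides the argument of the constant factor.\<close>

lemma chi_inf_degree:
  assumes A: "sym_mat (Suc n) A" and nz: "\<exists>j\<le>n. A $$ (0,j) \<noteq> 0"
  shows "A $$ (0,0) \<noteq> 0 \<Longrightarrow> degree (chi_inf n A) = n"
    and "A $$ (0,0) \<noteq> 0 \<Longrightarrow> lead_coeff (chi_inf n A) = (-1) ^ n * A $$ (0,0)"
    and "A $$ (0,0) = 0 \<Longrightarrow> n \<ge> 1 \<and> degree (chi_inf n A) = n - 1"
    and "A $$ (0,0) = 0 \<Longrightarrow> (-1) ^ n * lead_coeff (chi_inf n A) > 0"
proof -
  have Ac: "A \<in> carrier_mat (Suc n) (Suc n)" using A by (simp add: sym_mat_def)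
  have c1: "coeff (chi_inf n A) n = (-1) ^ n * A $$ (0,0)"
    using rho_1[OF Ac] by (simp add: coeff_chi_inf)
  show deg: "degree (chi_inf n A) = n" if "A $$ (0,0) \<noteq> 0"
    using that by (intro degree_eqI_coeff) (simp add: c1, simp add: coeff_chi_inf)
  show "lead_coeff (chi_inf n A) = (-1) ^ n * A $$ (0,0)" if "A $$ (0,0) \<noteq> 0"
    using deg[OF that] c1 by simp
  have *: "n \<ge> 1 \<and> degree (chi_inf n A) = n - 1 \<and> (-1) ^ n * lead_coeff (chi_inf n A) > 0"
    if a: "A $$ (0,0) = 0"
  proof -
    from nz obtain j where j: "j \<le> n" "A $$ (0,j) \<noteq> 0" by blast
    with a obtain k where k: "j = Suc k" "k < n" by (cases j) auto
    then have n: "n \<ge> 1" by simp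
    have "rho n 2 A = - (\<Sum>j<n. (A $$ (0, Suc j))\<^sup>2)"
      unfolding rho_2[OF Ac n] sum_negf[symmetric]
    proof (intro sum.cong refl)
      fix j assume "j \<in> {..<n}"
      then have "A $$ (Suc j, 0) = A $$ (0, Suc j)"
        by (intro sym_mat_index[OF A]) auto
      then show "A $$ (0,0) * A $$ (Suc j, Suc j) - A $$ (0, Suc j) * A $$ (Suc j, 0)
          = - (A $$ (0, Suc j))\<^sup>2"
        using a by (simp add: power2_eq_square)
    qed
    moreover have "(\<Sum>j<n. (A $$ (0, Suc j))\<^sup>2) > 0"
      using j k by (intro sum_pos2[of _ k]) auto
    ultimately have r: "rho n 2 A < 0" by simp
    have c2: "coeff (chi_inf n A) (n - 1) = (-1) ^ (n - 1) * rho n 2 A"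
      using n by (simp add: coeff_chi_inf numeral_2_eq_2)
    have top: "coeff (chi_inf n A) i = 0" if "i > n - 1" for i
      using that c1 a by (cases "i = n") (auto simp: coeff_chi_inf)
    have deg: "degree (chi_inf n A) = n - 1"
      using r c2 top by (intro degree_eqI_coeff) auto
    obtain m where "n = Suc m" using n by (cases n) auto
    then have "(-1) ^ n * lead_coeff (chi_inf n A) = - rho n 2 A"
      using c2 deg by simp
    with r n deg show ?thesis by simp
  qed
  show "n \<ge> 1 \<and> degree (chi_inf n A) = n - 1" if "A $$ (0,0) = 0"
    using *[OF that] by simp
  show "(-1) ^ n * lead_coeff (chi_inf n A) > 0" if "A $$ (0,0) = 0"
    using *[OF that] by blast
qed

lemma Arg_i_times_of_real:
  assumes "a \<noteq> 0"
  shows "Arg (\<i> * of_real a) = pi / 2 * sgn a"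
proof (rule Arg_unique)
  show "of_real \<bar>a\<bar> * exp (\<i> * complex_of_real (pi / 2 * sgn a)) = \<i> * of_real a"
    using assms by (auto simp: complex_eq_iff Re_exp Im_exp sgn_if)
qed (use assms in \<open>auto simp: sgn_if\<close>)

text \<open>The corner path is constantly 0, so the determinant is \<open>chi_inf\<close> on the
  imaginary axis up to a constant. The argument of that constant is the sign term.\<close>

lemma chi_inf_arctan_eq:
  assumes A: "sym_mat (Suc n) A" and nz: "\<exists>j\<le>n. A $$ (0,j) \<noteq> 0"
  shows "pi / 2 * sgn (A $$ (0,0)) + (\<Sum>x\<in>#proots (chi_inf n A). arctan x)
      = tr_arctan (Aplus n A)
    + Arg (det (diag_plus_i (Suc n) (\<lambda>i. if i = 0 then 0 else 1) A)
        / det (diag_plus_i n (\<lambda>_. 1) (Aplus n A)))"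
    and "size (proots (chi_inf n A)) = degree (chi_inf n A)"
proof -
  have Ac: "A \<in> carrier_mat (Suc n) (Suc n)" using A by (simp add: sym_mat_def)
  let ?\<chi> = "chi_inf n A"
  have no_roots: "poly (map_poly complex_of_real ?\<chi>) z \<noteq> 0" if "Im z > 0" for z
    using that nz unfolding poly_chi_inf[OF Ac]
    by (intro no_zero_divisors det_diag_plus_i_nonzero[OF A]) (auto simp: less_Suc_eq_le)
  have nz\<chi>: "?\<chi> \<noteq> 0"
    using no_roots[of \<i>] by auto
  show "size (proots ?\<chi>) = degree ?\<chi>"
    using real_rooted_poly_eval(2)[OF nz\<chi> no_roots] .
  \<comment> \<open>The leading coefficient and the powers of \<open>\<i>\<close> come from
    \<open>poly_eval_imaginary\<close>; \<open>\<i> ^ Suc n\<close> inverts the factor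
    \<open>(- \<i>) ^ Suc n\<close> of \<open>poly_chi_inf\<close>.\<close>
  define c where "c = \<i> ^ Suc n * \<i> ^ degree ?\<chi> * of_real (lead_coeff ?\<chi>)"
  \<comment> \<open>With degree \<open>n\<close> one factor \<open>\<i>\<close> is left over and
    \<open>c\<close> is imaginary; with degree \<open>n - 1\<close> the powers pair up and
    \<open>c\<close> is a positive real, of argument 0.\<close>
  have c_cases: "A $$ (0,0) \<noteq> 0 \<and> c = \<i> * of_real (A $$ (0,0)) \<or>
    A $$ (0,0) = 0 \<and> c = of_real ((-1) ^ n * lead_coeff ?\<chi>) \<and> (-1) ^ n * lead_coeff ?\<chi> > 0"
  proof (cases "A $$ (0,0) = 0")
    case True
    note * = chi_inf_degree(3,4)[OF A nz True]
    have "\<i> ^ Suc n * \<i> ^ degree ?\<chi> = \<i> ^ (n + n)"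
      using *(1) by (simp flip: power_add power_Suc)
    also have "\<dots> = (-1) ^ n"
      by (simp add: power_add flip: power_mult_distrib)
    finally show ?thesis
      using * True by (simp add: c_def)
  next
    case False
    note * = chi_inf_degree(1,2)[OF A nz False]
    have "\<i> ^ n * \<i> ^ n * ((-1) ^ n) = (1 :: complex)"
      by (simp flip: power_mult_distrib)
    then show ?thesis
      using False unfolding c_def *(2) unfolding *(1) by (simp add: mult_ac)
  qed
  have c: "c \<noteq> 0" "Re c \<ge> 0" and Arg_c: "Arg c = pi / 2 * sgn (A $$ (0,0))"
    using c_cases by (auto simp: Arg_i_times_of_real simp del: of_real_mult of_real_power)
  have "Arg c + (\<Sum>x\<in>#shifted_roots ?\<chi>. Arg x) = tr_arctan (Aplus n A)
    + Arg (det (diag_plus_i (Suc n) (\<lambda>i. if i = 0 then of_real 0 else 1) A)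
        / det (diag_plus_i n (\<lambda>_. 1) (Aplus n A)))"
  proof (rule sum_Arg_bordered[OF A shifted_roots_Re c, where \<delta> = "\<lambda>_. 0"])
    fix s :: real
    let ?D = "det (diag_plus_i (Suc n) (\<lambda>i. if i = 0 then of_real 0 else of_real (1 + s)) A)"
    have "(- \<i>) ^ Suc n * ?D = poly (map_poly complex_of_real ?\<chi>) (\<i> * of_real (1 + s))"
      unfolding poly_chi_inf[OF Ac] by (simp add: mult.assoc[symmetric] cong: if_cong)
    also have "\<dots> = of_real (lead_coeff ?\<chi>) * \<i> ^ degree ?\<chi> * (\<Prod>x\<in>#shifted_roots ?\<chi>. x + of_real s)"
      by (rule poly_eval_imaginary[OF nz\<chi> no_roots])
    finally have e: "(- \<i>) ^ Suc n * ?D =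
      of_real (lead_coeff ?\<chi>) * \<i> ^ degree ?\<chi> * (\<Prod>x\<in>#shifted_roots ?\<chi>. x + of_real s)" .
    have "\<i> ^ Suc n * (- \<i>) ^ Suc n * ?D = c * (\<Prod>x\<in>#shifted_roots ?\<chi>. x + of_real s)"
      unfolding c_def mult.assoc e by (simp only: mult_ac)
    moreover have "\<i> ^ Suc n * (- \<i>) ^ Suc n = 1"
      by (simp only: power_mult_distrib[symmetric]) simp
    ultimately show "?D = c * (\<Prod>x\<in>#shifted_roots ?\<chi>. x + of_real s)"
      by (simp only: mult_1_left)
  qed auto
  then show "pi / 2 * sgn (A $$ (0,0)) + (\<Sum>x\<in>#proots ?\<chi>. arctan x)
      = tr_arctan (Aplus n A)
    + Arg (det (diag_plus_i (Suc n) (\<lambda>i. if i = 0 then 0 else 1) A)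
        / det (diag_plus_i n (\<lambda>_. 1) (Aplus n A)))"
    by (simp add: Arg_c sum_Arg_shifted_roots cong: if_cong)
qed

section \<open>From the roots of \<open>chi_inf\<close> to the list of the \<open>mu\<close>\<close>

lemma sum_arctan_mu:
  assumes A: "sym_mat (Suc n) A" and nz: "\<exists>j\<le>n. A $$ (0,j) \<noteq> 0"
  shows "(\<Sum>j=1..n. arctan (mu n A j)) = (\<Sum>x\<in>#proots (chi_inf n A). arctan x)"
proof -
  \<comment> \<open>For corner entry 0 there are only \<open>n - 1\<close> roots, and the appended 0
    restores the length; it adds \<open>arctan 0 = 0\<close> to the sum.\<close>
  have len: "length (mu_list n A) = n"
    using chi_inf_arctan_eq(2)[OF A nz] chi_inf_degree[OF A nz]
    by (auto simp: mu_list_def size_mset[symmetric] simp del: size_mset)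
  have "(\<Sum>j=1..n. arctan (mu n A j)) = (\<Sum>j=0..<n. arctan (mu_list n A ! j))"
    unfolding mu_def by (rule sum.reindex_bij_witness[of _ Suc "\<lambda>j. j - 1"]) auto
  also have "\<dots> = sum_list (map arctan (mu_list n A))"
    using len by (simp add: sum_list_sum_nth)
  also have "\<dots> = (\<Sum>x\<in>#mset (mu_list n A). arctan x)"
    by (simp flip: sum_mset_sum_list)
  also have "\<dots> = (\<Sum>x\<in>#proots (chi_inf n A). arctan x)"
    by (simp add: mu_list_def)
  finally show ?thesis .
qed

lemma first_row_nonzero:
  assumes A: "sym_mat (n + 1) A" and ne: "A \<noteq> diag0_Aplus n A"
  shows "\<exists>j\<le>n. A $$ (0,j) \<noteq> 0"
proof (rule ccontr)
  assume "\<not> (\<exists>j\<le>n. A $$ (0,j) \<noteq> 0)"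
  then have z: "A $$ (0,j) = 0" "A $$ (j,0) = 0" if "j < Suc n" for j
    using that sym_mat_index[OF A, of 0 j] by auto
  have "A \<in> carrier_mat (Suc n) (Suc n)" using A by (simp add: sym_mat_def)
  with z have "A = diag0_Aplus n A"
    by (intro eq_matI) (auto simp: diag0_Aplus_def Aplus_def)
  with ne show False by simp
qed

theorem theoremA4:
  fixes n :: nat and A :: "real mat"
  assumes "sym_mat (n+1) A"
    and "A \<noteq> diag0_Aplus n A"
  shows "((\<lambda>p. tr_arctan (A_p n A p)) \<longlongrightarrow> Theta_hat n A) at_top
    \<and> Theta_hat n A = pi / 2 * sgn (A $$ (0,0)) + (\<Sum>j=1..n. arctan (mu n A j))"
proof
  have A: "sym_mat (Suc n) A" using assms(1) by simp
  have nz: "\<exists>j\<le>n. A $$ (0,j) \<noteq> 0" using first_row_nonzero[OF assms] .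
  let ?B = "diag_plus_i (Suc n) (\<lambda>i. if i = 0 then 0 else 1) A"
  let ?B' = "diag_plus_i n (\<lambda>_. 1) (Aplus n A)"
  let ?q = "det ?B / det ?B'"
  have "det ?B \<noteq> 0"
    using nz by (intro det_diag_plus_i_nonzero[OF A]) (auto simp: less_Suc_eq_le)
  moreover have "det ?B' \<noteq> 0"
    by (intro det_diag_plus_i_nonzero sym_mat_Aplus A) auto
  moreover have "Re ?q \<ge> 0"
    using Re_det_diag_plus_i_divide_minor[OF A, of "\<lambda>i. if i = 0 then 0 else 1"] by simp
  \<comment> \<open>The pivot may be purely imaginary but avoids the branch cut, so
    \<open>Arg\<close> is continuous at it and the limit can be taken inside.\<close>
  ultimately have q: "?q \<notin> \<real>\<^sub>\<le>\<^sub>0"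
    by (intro not_nonpos_Reals_if_Re_nonneg) auto
  have "((\<lambda>p::real. 1 / p\<^sup>2) \<longlongrightarrow> 0) at_top"
    by (intro tendsto_divide_0[OF tendsto_const] filterlim_at_top_imp_at_infinity
        filterlim_pow_at_top filterlim_ident) auto
  then have "((\<lambda>p::real. ?q + of_real (1 / p\<^sup>2)) \<longlongrightarrow> ?q + of_real 0) at_top"
    by (intro tendsto_intros)
  then have "((\<lambda>p::real. tr_arctan (Aplus n A) + Arg (?q + of_real (1 / p\<^sup>2)))
      \<longlongrightarrow> tr_arctan (Aplus n A) + Arg ?q) at_top"
    using q by (intro tendsto_add tendsto_const tendsto_Arg) auto
  moreover have "eventually (\<lambda>p. tr_arctan (A_p n A p)
      = tr_arctan (Aplus n A) + Arg (?q + of_real (1 / p\<^sup>2))) at_top"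
    using eventually_gt_at_top[of "0::real"] by eventually_elim (rule tr_arctan_A_p[OF A])
  ultimately show "((\<lambda>p. tr_arctan (A_p n A p)) \<longlongrightarrow> Theta_hat n A) at_top"
    unfolding Theta_hat_eq[OF A nz] using tendsto_cong by fastforce
  show "Theta_hat n A = pi / 2 * sgn (A $$ (0,0)) + (\<Sum>j=1..n. arctan (mu n A j))"
    unfolding Theta_hat_eq[OF A nz] sum_arctan_mu[OF A nz] chi_inf_arctan_eq(1)[OF A nz] ..
qed

end
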